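(* For each diameter diminishing to zero iterated function system $\mathcal{S}=((X,d),(f_i)_{i\in I})$, with associated function $\pi:\Lambda(I)\to X$, $\pi(\omega)=a_\omega$, we have $$f_i\circ\pi=\pi\circ\tau_i$$ for every $i\in I$.
   Context: Metric spaces are nonempty. For a metric space $(X,d)$, $P_b(X)$ is the set of nonempty bounded subsets of $X$ and $P_{b,cl}(X)$ the set of nonempty bounded closed subsets. An iterated function system (IFS) is a pair $\mathcal{S}=((X,d),(f_i)_{i\in I})$ where $(X,d)$ is a complete metric space, $I$ is a nonempty finite set, each $f_i:X\to X$ is continuous, and $f_i(B)\in P_b(X)$ for every $B\in P_b(X)$ and $i\in I$. Its fractal operator $F_{\mathcal{S}}:P_{b,cl}(X)\to P_{b,cl}(X)$ is $F_{\mathcal{S}}(B)=\overline{\bigcup_{i\in I}f_i(B)}$. $\mathbb{N}^*=\{1,2,\dots\}$. $\Lambda(I)=I^{\mathbb{N}^*}$ is the set of infinite words $\omega=\omega_1\omega_2\dots$ over $I$; $\Lambda_n(I)$ is the set of words of length $n$ over $I$; $[\omega]_n=\omega_1\dots\omega_n$ for $\omega\in\Lambda(I)$; $f_\omega=f_{\omega_1}\circ\dots\circ f_{\omega_n}$ for $\omega=\omega_1\dots\omega_n\in\Lambda_n(I)$. For $i\in I$, $\tau_i:\Lambda(I)\to\Lambda(I)$ is $\tau_i(\omega)=i\omega$ (concatenation). An IFS $\mathcal{S}$ is diameter diminishing to zero if for every $B\in P_{b,cl}(X)$ there exists $M_B\in P_{b,cl}(X)$ such that $B\subseteq M_B$,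 $F_{\mathcal{S}}(M_B)\subseteq M_B$ and $\lim_{n\to\infty}\max_{\omega\in\Lambda_n(I)}\mathrm{diam}(f_\omega(M_B))=0$. For a diameter diminishing to zero IFS and $\omega\in\Lambda(I)$, $a_\omega\in X$ denotes the unique point (it exists) such that $\bigcap_{n\in\mathbb{N}^*}\overline{f_{[\omega]_n}(B)}=\{a_\omega\}$ for every $B\in P_{b,cl}(X)$ with $F_{\mathcal{S}}(B)\subseteq B$; and $\pi:\Lambda(I)\to X$ is defined by $\pi(\omega)=a_\omega$. *)

theory Defs
  imports "HOL-Analysis.Analysis" "HOL-Library.Stream"
begin

text \<open>
  A complete metric space is a type of class \<open>complete_space\<close>, and a nonempty finite
  index set is a type of class \<open>finite\<close>; nonemptiness is automatic because types are nonempty.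
  An iterated function system is thus given by its family of maps
  \<open>f :: 'i::finite \<Rightarrow> 'a::complete_space \<Rightarrow> 'a\<close>.
  Infinite words over the index set are streams: the n-th letter (counted from 1) of
  \<open>\<omega> :: 'i stream\<close> is \<open>\<omega> !! (n - 1)\<close>, and its prefix of length n is
  \<open>stake n \<omega>\<close>. Finite words are lists.
\<close>

definition P_b :: "'a::metric_space set set" where
  "P_b = {B. B \<noteq> {} \<and> bounded B}"

definition P_bcl :: "'a::metric_space set set" where
  "P_bcl = {B. B \<noteq> {} \<and> bounded B \<and> closed B}"

definition ifs :: "('i::finite \<Rightarrow> 'a::complete_space \<Rightarrow> 'a) \<Rightarrow> bool" where
  "ifs f \<longleftrightarrow> (\<forall>i. continuous_on UNIV (f i)) \<and> (\<forall>B\<in>P_b. \<forall>i. f i ` B \<in> P_b)"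

definition fractal_operator ::
  "('i::finite \<Rightarrow> 'a::complete_space \<Rightarrow> 'a) \<Rightarrow> 'a set \<Rightarrow> 'a set" where
  "fractal_operator f B = closure (\<Union>i. f i ` B)"

definition words :: "nat \<Rightarrow> 'i list set" where
  "words n = {w. length w = n}"

fun word_map :: "('i \<Rightarrow> 'a \<Rightarrow> 'a) \<Rightarrow> 'i list \<Rightarrow> 'a \<Rightarrow> 'a" where
  "word_map f [] = id"
| "word_map f (i # w) = f i \<circ> word_map f w"

definition prepend :: "'i \<Rightarrow> 'i stream \<Rightarrow> 'i stream" where
  "prepend i \<omega> = i ## \<omega>"

definition diam_diminishing :: "('i::finite \<Rightarrow> 'a::complete_space \<Rightarrow> 'a) \<Rightarrow> bool" where
  "diam_diminishing f \<longleftrightarrow>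
     (\<forall>B\<in>P_bcl. \<exists>M\<in>P_bcl. B \<subseteq> M \<and> fractal_operator f M \<subseteq> M \<and>
        (\<lambda>n. MAX w\<in>words n. diameter (word_map f w ` M)) \<longlonglongrightarrow> 0)"

text \<open>
  The point \<open>a\<^sub>\<omega>\<close> and the associated function \<open>\<pi>\<close>. The description is meaningful
  (the point exists and is unique) when \<open>f\<close> is a diameter diminishing to zero
  iterated function system; the value is unspecified otherwise.
\<close>

definition attr_point ::
  "('i::finite \<Rightarrow> 'a::complete_space \<Rightarrow> 'a) \<Rightarrow> 'i stream \<Rightarrow> 'a" where
  "attr_point f \<omega> =
     (THE a. \<forall>B\<in>P_bcl. fractal_operator f B \<subseteq> B \<longrightarrow>
        (\<Inter>n\<in>{1..}. closure (word_map f (stake n \<omega>) ` B)) = {a})"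

definition code_map ::
  "('i::finite \<Rightarrow> 'a::complete_space \<Rightarrow> 'a) \<Rightarrow> 'i stream \<Rightarrow> 'a" where
  "code_map f = (\<lambda>\<omega>. attr_point f \<omega>)"

end

theory Submission
  imports Defs
begin

text \<open>
  If \<open>B\<close> is bounded, closed, nonempty and invariant under the fractal operator, then the sets
  \<open>closure (word_map f (stake n \<omega>) ` B)\<close> decrease with \<open>n\<close>. Their diameters tend to zero: \<open>B\<close>
  lies in a set \<open>M\<close> whose images under words of length \<open>n\<close> shrink uniformly. By Cantor's
  intersection theorem they have exactly one common point. This point does not depend on \<open>B\<close>:
  two invariant sets lie in a common invariant one, whose single common point then has to be
  the point of both. So the description of \<open>attr_point f \<omega>\<close> is
  meaningful, and \<open>code_map_Inter\<close> gives its defining property.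

  The functional equation then amounts to a membership. Continuity of \<open>f i\<close> carries the point
  of \<open>\<omega>\<close>, which lies in the closure of the image of \<open>B\<close> under the first \<open>n\<close> letters of \<open>\<omega>\<close>, into
  the closure of the image of \<open>B\<close> under the first \<open>n + 1\<close> letters of \<open>i\<omega>\<close>. Hence \<open>f i\<close> of it
  belongs to the one-point intersection that defines the point of \<open>i\<omega>\<close>.
\<close>

lemma word_map_append: "word_map f (u @ v) = word_map f u \<circ> word_map f v"
  by (induction u) auto

lemma bounded_word_map_image:
  assumes "ifs f" and "bounded B"
  shows "bounded (word_map f w ` B)"
proof (induction w)
  case Nil
  then show ?case using assms(2) by simp
next
  case (Cons i w)
  have "bounded (f i ` A)" if "bounded A" for A
    using assms(1) that by (cases "A = {}") (auto simp: ifs_def P_b_def)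
  from this[OF Cons.IH] show ?case
    by (simp add: image_comp)
qed

lemma image_subset_of_invariant:
  assumes "fractal_operator f B \<subseteq> B"
  shows "f i ` B \<subseteq> B"
  using assms closure_subset[of "\<Union>i. f i ` B"] unfolding fractal_operator_def by blast

lemma decseq_closure_word_map:
  assumes "fractal_operator f B \<subseteq> B"
  shows "decseq (\<lambda>n. closure (word_map f (stake n \<omega>) ` B))"
proof (rule decseq_SucI)
  fix n
  \<comment> \<open>The new letter of a longer prefix acts first, so it only replaces \<open>B\<close> by a subset of \<open>B\<close>.\<close>
  have "word_map f (stake (Suc n) \<omega>) ` B = word_map f (stake n \<omega>) ` f (\<omega> !! n) ` B"
    by (simp add: stake_Suc word_map_append image_comp del: stake.simps)
  also have "\<dots> \<subseteq> word_map f (stake n \<omega>) ` B"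
    using image_subset_of_invariant[OF assms] by (rule image_mono)
  finally show "closure (word_map f (stake (Suc n) \<omega>) ` B) \<subseteq> closure (word_map f (stake n \<omega>) ` B)"
    by (rule closure_mono)
qed

text \<open>
  The shrinking property passes from \<open>M\<close> to every set inside it, in particular to an invariant
  set for which the hypothesis only supplies a larger \<open>M\<close>.
\<close>

lemma diameter_word_map_tendsto_0:
  fixes f :: "'i::finite \<Rightarrow> 'a::complete_space \<Rightarrow> 'a"
  assumes "ifs f" and "diam_diminishing f" and "B \<in> P_bcl"
  shows "(\<lambda>n. diameter (word_map f (stake n \<omega>) ` B)) \<longlonglongrightarrow> 0"
proof -
  from assms(2,3) obtain M where M: "M \<in> P_bcl" "B \<subseteq> M"
    and lim: "(\<lambda>n. MAX w\<in>words n. diameter (word_map f w ` M)) \<longlonglongrightarrow> 0"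
    unfolding diam_diminishing_def by blast
  have bounded_M: "bounded (word_map f w ` M)" for w
    using bounded_word_map_image[OF assms(1)] M(1) by (auto simp: P_bcl_def)
  have finite_words: "finite (words n :: 'i list set)" for n
    using finite_lists_length_eq[of "UNIV :: 'i set" n] by (simp add: words_def)
  have upper: "diameter (word_map f (stake n \<omega>) ` B)
      \<le> (MAX w\<in>words n. diameter (word_map f w ` M))" for n
  proof -
    have "diameter (word_map f (stake n \<omega>) ` B) \<le> diameter (word_map f (stake n \<omega>) ` M)"
      using M(2) bounded_M by (intro diameter_subset image_mono)
    also have "\<dots> \<le> (MAX w\<in>words n. diameter (word_map f w ` M))"
      using finite_words by (intro Max_ge) (auto simp: words_def)
    finally show ?thesis .
  qed
  have lower: "0 \<le> diameter (word_map f (stake n \<omega>) ` B)" for n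
    using bounded_M M(2) by (meson diameter_ge_0 bounded_subset image_mono)
  show ?thesis
    by (rule real_tendsto_sandwich[OF _ _ tendsto_const lim]) (simp_all add: lower upper)
qed

lemma ex_Inter_eq_singleton:
  fixes f :: "'i::finite \<Rightarrow> 'a::complete_space \<Rightarrow> 'a"
  assumes "ifs f" and "diam_diminishing f" and "B \<in> P_bcl" and "fractal_operator f B \<subseteq> B"
  shows "\<exists>a. (\<Inter>n\<in>{1..}. closure (word_map f (stake n \<omega>) ` B)) = {a}"
proof -
  define S where "S n = closure (word_map f (stake n \<omega>) ` B)" for n
  have dec: "S n \<subseteq> S m" if "m \<le> n" for m n
    using decseq_closure_word_map[OF assms(4), of \<omega>] that by (auto simp: S_def decseq_def)
  have "\<exists>a. \<Inter>(range S) = {a}"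
  proof (rule decreasing_closed_nest_sing)
    show "closed (S n)" and "S n \<noteq> {}" for n
      using assms(3) by (auto simp: S_def P_bcl_def)
    show "S n \<subseteq> S m" if "m \<le> n" for m n
      using dec that .
    show "\<exists>n. \<forall>x\<in>S n. \<forall>y\<in>S n. dist x y < e" if e: "e > 0" for e
    proof -
      have bounded_image: "bounded (word_map f (stake n \<omega>) ` B)" for n
        using bounded_word_map_image[OF assms(1)] assms(3) by (auto simp: P_bcl_def)
      obtain n where "diameter (word_map f (stake n \<omega>) ` B) < e"
        using order_tendstoD(2)[OF diameter_word_map_tendsto_0[OF assms(1-3), of \<omega>] e]
        by (auto simp: eventually_sequentially)
      then have "diameter (S n) < e"
        using bounded_image by (simp add: S_def diameter_closure)
      moreover have "bounded (S n)"
        using bounded_image by (simp add: S_def bounded_closure)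
      ultimately show ?thesis
        by (meson diameter_bounded_bound le_less_trans)
    qed
  qed
  moreover have "\<Inter>(range S) = (\<Inter>n\<in>{1..}. S n)"
  proof (rule subset_antisym)
    show "(\<Inter>n\<in>{1..}. S n) \<subseteq> \<Inter>(range S)"
    proof (intro INT_greatest)
      fix n
      have "(\<Inter>n\<in>{1..}. S n) \<subseteq> S (Suc n)" by auto
      also have "\<dots> \<subseteq> S n" by (rule dec) simp
      finally show "(\<Inter>n\<in>{1..}. S n) \<subseteq> S n" .
    qed
  qed auto
  ultimately show ?thesis
    by (simp add: S_def)
qed

text \<open>
  Two invariant sets are compared through an invariant set \<open>M\<close> containing both: their one-point
  intersections lie in that of \<open>M\<close>, hence equal it.
\<close>

lemma code_map_Inter:
  fixes f :: "'i::finite \<Rightarrow> 'a::complete_space \<Rightarrow> 'a"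
  assumes "ifs f" and "diam_diminishing f" and "B \<in> P_bcl" and "fractal_operator f B \<subseteq> B"
  shows "(\<Inter>n\<in>{1..}. closure (word_map f (stake n \<omega>) ` B)) = {code_map f \<omega>}"
proof -
  define J where "J B = (\<Inter>n\<in>{1..}. closure (word_map f (stake n \<omega>) ` B))" for B
  have sing: "\<exists>a. J A = {a}" if "A \<in> P_bcl" "fractal_operator f A \<subseteq> A" for A
    using ex_Inter_eq_singleton[OF assms(1,2) that] by (simp add: J_def)
  have mono: "J A \<subseteq> J A'" if "A \<subseteq> A'" for A A'
    unfolding J_def using that by (intro INF_mono) (meson closure_mono image_mono)
  have same: "J A = J B" if A: "A \<in> P_bcl" "fractal_operator f A \<subseteq> A" for A
  proof -
    have "A \<union> B \<in> P_bcl"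
      using A(1) assms(3) by (auto simp: P_bcl_def)
    then obtain M where M: "M \<in> P_bcl" "A \<union> B \<subseteq> M" "fractal_operator f M \<subseteq> M"
      using assms(2) unfolding diam_diminishing_def by blast
    then have "J A \<subseteq> J M" "J B \<subseteq> J M"
      by (auto intro!: mono)
    then show ?thesis
      using sing[OF A] sing[OF assms(3,4)] sing[OF M(1,3)] by auto
  qed
  obtain a where a: "J B = {a}"
    using sing[OF assms(3,4)] by blast
  have "attr_point f \<omega> = a"
    unfolding attr_point_def J_def[symmetric]
  proof (rule the_equality)
    show "\<forall>A\<in>P_bcl. fractal_operator f A \<subseteq> A \<longrightarrow> J A = {a}"
      using same a by simp
    show "b = a" if "\<forall>A\<in>P_bcl. fractal_operator f A \<subseteq> A \<longrightarrow> J A = {b}" for b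
      using that assms(3,4) a by auto
  qed
  with a show ?thesis
    by (simp add: J_def code_map_def)
qed

theorem proposition3p3:
  fixes f :: "'i::finite \<Rightarrow> 'a::complete_space \<Rightarrow> 'a"
  assumes "ifs f"
    and "diam_diminishing f"
  shows "\<forall>i. f i \<circ> code_map f = code_map f \<circ> prepend i"
proof (intro allI ext)
  fix i \<omega>
  have "{undefined :: 'a} \<in> P_bcl"
    by (simp add: P_bcl_def)
  then obtain B where B: "B \<in> P_bcl" "fractal_operator f B \<subseteq> B"
    using assms(2) unfolding diam_diminishing_def by blast
  note point = code_map_Inter[OF assms B]
  \<comment> \<open>The empty prefix is included here, because it yields the one-letter prefix of \<open>i\<omega>\<close> below.\<close>
  have mem: "code_map f \<omega> \<in> closure (word_map f (stake n \<omega>) ` B)" for n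
  proof -
    have "code_map f \<omega> \<in> closure (word_map f (stake (Suc n) \<omega>) ` B)"
      using point[of \<omega>] by (auto simp del: stake.simps)
    then show ?thesis
      using decseq_SucD[OF decseq_closure_word_map[OF B(2)]] by blast
  qed
  have "f i (code_map f \<omega>) \<in> closure (word_map f (stake n (prepend i \<omega>)) ` B)" if "n \<ge> 1" for n
  proof -
    from that obtain m where m: "n = Suc m"
      by (cases n) auto
    have "continuous_on (closure A) (f i)" for A
      using assms(1) continuous_on_subset by (auto simp: ifs_def)
    then have "f i ` closure A \<subseteq> closure (f i ` A)" for A
      by (intro image_closure_subset closure_subset) auto
    then have "f i (code_map f \<omega>) \<in> closure (f i ` word_map f (stake m \<omega>) ` B)"
      using mem by blast
    then show ?thesis
      by (simp add: m prepend_def image_comp)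
  qed
  then show "(f i \<circ> code_map f) \<omega> = (code_map f \<circ> prepend i) \<omega>"
    using point[of "prepend i \<omega>"] by auto
qed

end
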